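(* Let $G$ be a cubic graph, let $F$ be any $1$-factor (perfect matching) of $G$, and let $\bar F = E(G)\setminus F$ be the complementary $2$-factor. Then there is a maximum $3$-edge-colorable subgraph $H$ of $G$ such that (a) $E(H)\cup F = E(G)$, and (b) $\bar F\subseteq E(H)$.
   Context: All graphs are finite and undirected, without loops; multiple edges are allowed. A cubic graph is a $3$-regular graph. For a graph $G$ and a positive integer $k$, let $\nu_k(G)$ be the maximum of $|H_1|+\dots+|H_k|$ over all $k$-tuples $(H_1,\dots,H_k)$ of pairwise edge-disjoint matchings of $G$. A subgraph $H$ of $G$ is called maximum $k$-edge-colorable if it is $k$-edge-colorable (properly) and has exactly $\nu_k(G)$ edges. *)

theory Defs
  imports Main
begin

text \<open>Undirected multigraphs: edges are abstract objects, so distinct edges may have the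
  same set of ends (parallel edges); requiring exactly two ends excludes loops.\<close>

record ('v, 'e) mgraph =
  verts :: "'v set"
  edges :: "'e set"
  ends :: "'e \<Rightarrow> 'v set"

definition multigraph :: "('v, 'e) mgraph \<Rightarrow> bool" where
  "multigraph G \<longleftrightarrow> finite (verts G) \<and> finite (edges G) \<and>
     (\<forall>e\<in>edges G. ends G e \<subseteq> verts G \<and> card (ends G e) = 2)"

text \<open>As there are no loops, no edge has to be counted twice in the degree.\<close>

definition degree :: "('v, 'e) mgraph \<Rightarrow> 'v \<Rightarrow> nat" where
  "degree G v = card {e \<in> edges G. v \<in> ends G e}"

definition cubic :: "('v, 'e) mgraph \<Rightarrow> bool" where
  "cubic G \<longleftrightarrow> multigraph G \<and> (\<forall>v\<in>verts G. degree G v = 3)"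

definition subgraph :: "('v, 'e) mgraph \<Rightarrow> ('v, 'e) mgraph \<Rightarrow> bool" where
  "subgraph H G \<longleftrightarrow> multigraph H \<and> verts H \<subseteq> verts G \<and> edges H \<subseteq> edges G \<and>
     (\<forall>e\<in>edges H. ends H e = ends G e)"

definition matching :: "('v, 'e) mgraph \<Rightarrow> 'e set \<Rightarrow> bool" where
  "matching G M \<longleftrightarrow> M \<subseteq> edges G \<and>
     (\<forall>e\<in>M. \<forall>f\<in>M. e \<noteq> f \<longrightarrow> ends G e \<inter> ends G f = {})"

definition perfect_matching :: "('v, 'e) mgraph \<Rightarrow> 'e set \<Rightarrow> bool" where
  "perfect_matching G F \<longleftrightarrow> matching G F \<and> (\<forall>v\<in>verts G. \<exists>e\<in>F. v \<in> ends G e)"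

definition disjoint_matchings :: "('v, 'e) mgraph \<Rightarrow> nat \<Rightarrow> (nat \<Rightarrow> 'e set) \<Rightarrow> bool" where
  "disjoint_matchings G k M \<longleftrightarrow> (\<forall>i<k. matching G (M i)) \<and>
     (\<forall>i<k. \<forall>j<k. i \<noteq> j \<longrightarrow> M i \<inter> M j = {})"

definition nu :: "nat \<Rightarrow> ('v, 'e) mgraph \<Rightarrow> nat" where
  "nu k G = Max {(\<Sum>i<k. card (M i)) | M. disjoint_matchings G k M}"

definition edge_colorable :: "nat \<Rightarrow> ('v, 'e) mgraph \<Rightarrow> bool" where
  "edge_colorable k H \<longleftrightarrow> (\<exists>c :: 'e \<Rightarrow> nat. (\<forall>e\<in>edges H. c e < k) \<and>
     (\<forall>e\<in>edges H. \<forall>f\<in>edges H. e \<noteq> f \<and> ends H e \<inter> ends H f \<noteq> {} \<longrightarrow> c e \<noteq> c f))"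

definition maximum_edge_colorable :: "nat \<Rightarrow> ('v, 'e) mgraph \<Rightarrow> ('v, 'e) mgraph \<Rightarrow> bool" where
  "maximum_edge_colorable k G H \<longleftrightarrow>
     subgraph H G \<and> edge_colorable k H \<and> card (edges H) = nu k G"

text \<open>The maximum in the definition of \<open>nu\<close> is over a finite nonempty set.\<close>

lemma nu_set_finite_nonempty:
  assumes "multigraph G"
  shows "finite {(\<Sum>i<k. card (M i)) | M. disjoint_matchings G k M}"
    and "{(\<Sum>i<k. card (M i)) | M. disjoint_matchings G k M} \<noteq> {}"
proof -
  have fin: "finite (edges G)"
    using assms by (simp add: multigraph_def)
  have "(\<Sum>i<k. card (M i)) \<le> k * card (edges G)" if "disjoint_matchings G k M" for M
  proof -
    have "card (M i) \<le> card (edges G)" if "i < k" for i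
      using that \<open>disjoint_matchings G k M\<close> fin
      by (auto simp: disjoint_matchings_def matching_def intro: card_mono)
    then show ?thesis
      using sum_bounded_above[of "{..<k}" "\<lambda>i. card (M i)" "card (edges G)"] by simp
  qed
  then have "{(\<Sum>i<k. card (M i)) | M. disjoint_matchings G k M} \<subseteq> {..k * card (edges G)}"
    by auto
  then show "finite {(\<Sum>i<k. card (M i)) | M. disjoint_matchings G k M}"
    by (rule finite_subset) simp
  have "disjoint_matchings G k (\<lambda>_. {})"
    by (simp add: disjoint_matchings_def matching_def)
  then show "{(\<Sum>i<k. card (M i)) | M. disjoint_matchings G k M} \<noteq> {}"
    by blast
qed

end

theory Submission
  imports Defs "HOL-Combinatorics.Transposition"
begin

text \<open>Take a partial proper 3-edge-colouring with as many coloured edges as possible and, subject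
  to this, with as many coloured edges outside \<open>F\<close> as possible. Suppose that an edge \<open>uv\<close> outside
  \<open>F\<close> is uncoloured (a hole). If \<open>\<alpha>\<close> is missing at \<open>u\<close> and \<open>\<beta>\<close> at \<open>v\<close>, then giving \<open>uv\<close> the colour
  \<open>\<beta>\<close> and uncolouring the \<open>\<beta>\<close>-edge at \<open>u\<close> moves the hole; by the choice of the colouring that
  \<open>\<beta>\<close>-edge is not in \<open>F\<close>. Hence the \<open>F\<close>-edges at \<open>u\<close> and \<open>v\<close> both have the third colour \<open>\<gamma>\<close>, and
  the hole can be rotated around its cycle \<open>C\<close> of the 2-factor. So every \<open>F\<close>-edge at \<open>C\<close> has
  colour \<open>\<gamma>\<close> and \<open>C\<close> is odd.

  Each vertex of \<open>C\<close> is an end of an \<open>\<alpha>\<gamma>\<close>-path outside \<open>C\<close>. As \<open>C\<close> is odd, one of these paths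
  meets \<open>C\<close> in a single vertex \<open>t\<close>. Rotate the hole to an edge \<open>ts\<close> of \<open>C\<close> such that \<open>\<alpha>\<close> is missing
  at \<open>t\<close>, and exchange \<open>\<alpha>\<close> and \<open>\<gamma>\<close> on the path: now the \<open>F\<close>-edges at \<open>t\<close> and \<open>s\<close> have
  different colours, a contradiction.\<close>

section \<open>Parity and orbits of involutions on a finite set\<close>

text \<open>The two-element sets \<open>{x, a x}\<close> partition \<open>A\<close>; removing one of
  them leaves a set of the same kind.\<close>

lemma even_card_involution:
  assumes "finite A" "\<And>x. x \<in> A \<Longrightarrow> a x \<in> A" "\<And>x. x \<in> A \<Longrightarrow> a (a x) = x"
    "\<And>x. x \<in> A \<Longrightarrow> a x \<noteq> x"
  shows "even (card A)"
  using assms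
proof (induction A rule: finite_psubset_induct)
  case (psubset A)
  show ?case
  proof (cases "A = {}")
    case False
    then obtain x where x: "x \<in> A" by blast
    let ?B = "A - {x, a x}"
    have "?B \<subset> A" using x by blast
    moreover have "a y \<in> ?B" if "y \<in> ?B" for y
    proof -
      have "a y \<in> A" "a (a y) = y" "a (a x) = x" using psubset.prems(1,2) that x by blast+
      moreover from this have "a y \<noteq> x" "a y \<noteq> a x" using that by (auto dest: arg_cong[of _ _ a])
      ultimately show ?thesis by blast
    qed
    ultimately have "even (card ?B)"
      using psubset.IH[of ?B] psubset.prems by blast
    moreover have "card A = card ?B + 2"
    proof -
      have "card {x, a x} = 2" using psubset.prems(3)[OF x] by auto
      moreover have "{x, a x} \<subseteq> A" using x psubset.prems(1) by blast
      ultimately show ?thesis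
        using psubset.hyps by (metis card_Diff_subset card_mono finite.emptyI finite.insertI le_add_diff_inverse2)
    qed
    ultimately show ?thesis by simp
  qed simp
qed

text \<open>The orbits of two involutions are paths and cycles, and a fixed point of \<open>a\<close> is an end of a
  path; so every orbit contains at most two points of \<open>A\<close>, and by parity one of them contains
  just one. The induction cuts off an end of a path.\<close>

lemma involutions_orbit_single:
  assumes "finite V" "A \<subseteq> V" "odd (card A)" "\<And>x. x \<in> A \<Longrightarrow> a x = x"
    and "\<And>x. x \<in> V \<Longrightarrow> a x \<in> V \<and> a (a x) = x"
    and "\<And>x. x \<in> V \<Longrightarrow> c x \<in> V \<and> c (c x) = x"
  shows "\<exists>t S. S \<subseteq> V \<and> S \<inter> A = {t} \<and> a ` S \<subseteq> S \<and> c ` S \<subseteq> S"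
  using assms
proof (induction V arbitrary: A a rule: finite_psubset_induct)
  case (psubset V)
  note A = psubset.prems(1) and odd = psubset.prems(2) and fixA = psubset.prems(3)
    and a = psubset.prems(4) and c = psubset.prems(5)
  have finA: "finite A" using A psubset.hyps finite_subset by blast
  obtain t where t: "t \<in> A" using odd by fastforce
  define x where "x = c t"
  have tV: "t \<in> V" "x \<in> V" "c x = t" "a t = t" using t A c fixA unfolding x_def by blast+
  let ?V = "V - {t, x}"
  have sub: "?V \<subset> V" using tV by blast
  have cV: "c z \<in> ?V \<and> c (c z) = z" if "z \<in> ?V" for z
  proof -
    have that': "z \<in> V" using that by blast
    have "c z \<in> V" "c (c z) = z" using c[OF that'] by blast+
    moreover from this have "c z \<noteq> t" "c z \<noteq> x" using that tV(3) x_def by auto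
    ultimately show ?thesis by blast
  qed
  \<comment> \<open>As \<open>a\<close> fixes \<open>t\<close>, the orbit of \<open>t\<close> is a
    path starting \<open>t\<close>, \<open>x\<close>. In \<open>loop\<close> and \<open>tip\<close>
    it stops without a second point of \<open>A\<close>; in \<open>pair\<close> it stops at one, and
    dropping both keeps the parity; in \<open>inner\<close> it goes on to
    \<open>a x\<close>.\<close>
  consider (loop) "x = t" | (pair) "x \<noteq> t" "x \<in> A" | (tip) "x \<noteq> t" "x \<notin> A" "a x = x"
    | (inner) "x \<noteq> t" "x \<notin> A" "a x \<noteq> x" by blast
  then show ?case
  proof cases
    case loop
    then have "{t} \<subseteq> V \<and> {t} \<inter> A = {t} \<and> a ` {t} \<subseteq> {t} \<and> c ` {t} \<subseteq> {t}"
      using tV t by auto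
    then show ?thesis by (intro exI)
  next
    case pair
    have aV: "a z \<in> ?V \<and> a (a z) = z" if "z \<in> ?V" for z
    proof -
      have that': "z \<in> V" using that by blast
      have "a z \<in> V" "a (a z) = z" using a[OF that'] by blast+
      moreover from this have "a z \<noteq> t" "a z \<noteq> x" using that tV(4) fixA[OF pair(2)] by auto
      ultimately show ?thesis by blast
    qed
    have "card {t, x} = 2" using pair by auto
    moreover have "{t, x} \<subseteq> A" using pair t by blast
    ultimately have "card A = card (A - {t, x}) + 2"
      using finA by (metis card_Diff_subset card_mono finite.emptyI finite.insertI le_add_diff_inverse2)
    then have "odd (card (A - {t, x}))" using odd by simp
    then have "\<exists>s S. S \<subseteq> ?V \<and> S \<inter> (A - {t, x}) = {s} \<and> a ` S \<subseteq> S \<and> c ` S \<subseteq> S"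
      using A fixA by (intro psubset.IH[OF sub _ _ _ aV cV]) auto
    then obtain s S where S: "S \<subseteq> ?V" "S \<inter> (A - {t, x}) = {s}" "a ` S \<subseteq> S" "c ` S \<subseteq> S"
      by (elim exE conjE) (rule that)
    have "S \<subseteq> V" using S(1) by blast
    moreover have "S \<inter> A = S \<inter> (A - {t, x})" using S(1) by blast
    then have "S \<inter> A = {s}" using S(2) by simp
    ultimately show ?thesis using S(3,4) by (intro exI conjI)
  next
    case tip
    then have "{t, x} \<subseteq> V \<and> {t, x} \<inter> A = {t} \<and> a ` {t, x} \<subseteq> {t, x} \<and> c ` {t, x} \<subseteq> {t, x}"
      using tV t x_def by auto
    then show ?thesis by (intro exI)
  next
    case inner
    define y where "y = a x"
    have ax: "a x \<in> V" "a (a x) = x" using a[OF tV(2)] by blast+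
    have y: "y \<in> V" "a y = x" "y \<noteq> x" using ax inner unfolding y_def by auto
    have y': "y \<notin> A" "y \<noteq> t" using fixA[of y] y t by auto
    \<comment> \<open>The path is shortened by \<open>t\<close> and \<open>x\<close>:
      \<open>y\<close> becomes its end, hence a fixed point of \<open>?a\<close>, and replaces
      \<open>t\<close> among the marked points.\<close>
    let ?A = "insert y (A - {t})" and ?a = "a(y := y)"
    have aV: "?a z \<in> ?V \<and> ?a (?a z) = z" if "z \<in> ?V" for z
    proof (cases "z = y")
      case False
      have that': "z \<in> V" using that by blast
      have az: "a z \<in> V" "a (a z) = z" using a[OF that'] by blast+
      then have "a z \<noteq> y" "a z \<noteq> x" "a z \<noteq> t" using that False y(2) tV(4) y_def by auto
      then show ?thesis using az False by simp
    qed (use y y' in auto)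
    have "card ?A = card A"
      using y' finA t by (metis card_Suc_Diff1 card_insert_disjoint finite_Diff Diff_iff)
    then have "odd (card ?A)" using odd by simp
    moreover have "?a z = z" if "z \<in> ?A" for z using that fixA by auto
    moreover have "?A \<subseteq> ?V" using y y' A inner by auto
    ultimately have "\<exists>s S. S \<subseteq> ?V \<and> S \<inter> ?A = {s} \<and> ?a ` S \<subseteq> S \<and> c ` S \<subseteq> S"
      by (intro psubset.IH[OF sub _ _ _ aV cV])
    then obtain s S where S: "S \<subseteq> ?V" "S \<inter> ?A = {s}" "?a ` S \<subseteq> S" "c ` S \<subseteq> S"
      by (elim exE conjE) (rule that)
    show ?thesis
    proof (cases "y \<in> S")
      case True
      \<comment> \<open>The set found contains the shortened path, so the two removed points are
        attached again and \<open>t\<close> takes over from \<open>y\<close>.\<close>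
      let ?T = "insert t (insert x S)"
      have "s = y" using S(2) True by auto
      have "z \<notin> A" if "z \<in> S" for z
      proof
        assume "z \<in> A"
        then have "z \<in> S \<inter> ?A" using that S(1) by auto
        then show False using S(2) \<open>s = y\<close> y'(1) \<open>z \<in> A\<close> by simp
      qed
      then have "S \<inter> A = {}" by auto
      then have "?T \<inter> A = {t}" using t inner by blast
      moreover have "a z \<in> ?T" if "z \<in> S" for z
        using S(3) that y_def y by (cases "z = y") auto
      then have "a ` ?T \<subseteq> ?T" using tV True y_def by auto
      moreover have "c ` ?T \<subseteq> ?T" using tV x_def S(4) by auto
      moreover have "?T \<subseteq> V" using S(1) tV by blast
      ultimately show ?thesis by (intro exI conjI)
    next
      case False
      then have "a ` S \<subseteq> S" using S(3) by auto
      moreover have "S \<inter> A = S \<inter> ?A" using S(1) False by auto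
      then have "S \<inter> A = {s}" using S(2) by simp
      moreover have "S \<subseteq> V" using S(1) by blast
      ultimately show ?thesis using S(4) by (intro exI conjI)
    qed
  qed
qed

section \<open>The involution of a matching\<close>

text \<open>A matching becomes an involution on the vertices that fixes the unmatched ones, so that
  alternating paths of two matchings are orbits of two involutions.\<close>

definition mate :: "('v, 'e) mgraph \<Rightarrow> 'e set \<Rightarrow> 'v \<Rightarrow> 'v" where
  "mate G M w = (if \<exists>x. \<exists>g\<in>M. x \<noteq> w \<and> ends G g = {w, x}
     then THE x. \<exists>g\<in>M. x \<noteq> w \<and> ends G g = {w, x} else w)"

lemma mate_eq:
  assumes "matching G M" "g \<in> M" "ends G g = {w, x}" "x \<noteq> w"
  shows "mate G M w = x"
proof -
  have "(THE x. \<exists>g\<in>M. x \<noteq> w \<and> ends G g = {w, x}) = x"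
  proof (rule the_equality)
    fix y assume "\<exists>g\<in>M. y \<noteq> w \<and> ends G g = {w, y}"
    then obtain h where h: "h \<in> M" "y \<noteq> w" "ends G h = {w, y}" by blast
    then have "h = g" using assms unfolding matching_def by blast
    then show "y = x" using h assms by (metis doubleton_eq_iff)
  qed (use assms in blast)
  then show ?thesis unfolding mate_def using assms by auto
qed

lemma mate_self:
  assumes "\<And>g. g \<in> M \<Longrightarrow> w \<notin> ends G g"
  shows "mate G M w = w"
  using assms unfolding mate_def by auto

lemma mate_cases:
  assumes "matching G M"
  obtains "mate G M w = w"
  | g where "g \<in> M" "ends G g = {w, mate G M w}" "mate G M w \<noteq> w"
proof (cases "\<exists>x. \<exists>g\<in>M. x \<noteq> w \<and> ends G g = {w, x}")
  case True
  then obtain x g where "g \<in> M" "x \<noteq> w" "ends G g = {w, x}" by blast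
  then show ?thesis using that(2)[of g] mate_eq[OF assms] by metis
next
  case False
  then show ?thesis using that(1) unfolding mate_def by argo
qed

lemma mate_mate:
  assumes "matching G M"
  shows "mate G M (mate G M w) = w"
proof (cases rule: mate_cases[OF assms, of w])
  case (2 g)
  then show ?thesis using mate_eq[OF assms, of g "mate G M w" w] by (metis insert_commute)
qed simp

lemma mate_in_verts:
  assumes "multigraph G" "matching G M" "w \<in> verts G"
  shows "mate G M w \<in> verts G"
proof (cases rule: mate_cases[OF assms(2), of w])
  case (2 g)
  then have "g \<in> edges G" using assms(2) unfolding matching_def by blast
  then have "{w, mate G M w} \<subseteq> verts G" using assms(1) 2 unfolding multigraph_def by metis
  then show ?thesis by blast
qed (use assms in simp)

section \<open>Partial colourings and their weight\<close>

text \<open>A partial colouring is encoded by a total function; an edge with a value \<open>\<ge> 3\<close> is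
  uncoloured.\<close>

definition coloured :: "('v, 'e) mgraph \<Rightarrow> ('e \<Rightarrow> nat) \<Rightarrow> 'e set" where
  "coloured G c = {e \<in> edges G. c e < 3}"

definition proper :: "('v, 'e) mgraph \<Rightarrow> ('e \<Rightarrow> nat) \<Rightarrow> bool" where
  "proper G c \<longleftrightarrow> (\<forall>e\<in>coloured G c. \<forall>f\<in>coloured G c.
     e \<noteq> f \<and> ends G e \<inter> ends G f \<noteq> {} \<longrightarrow> c e \<noteq> c f)"

text \<open>The weight orders colourings lexicographically, by the number of coloured edges and then by
  the number of coloured edges outside \<open>F\<close>.\<close>

definition weight :: "('v, 'e) mgraph \<Rightarrow> 'e set \<Rightarrow> ('e \<Rightarrow> nat) \<Rightarrow> nat" where
  "weight G F c = card (coloured G c) * Suc (card (edges G)) + card (coloured G c - F)"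

definition optimal :: "('v, 'e) mgraph \<Rightarrow> 'e set \<Rightarrow> ('e \<Rightarrow> nat) \<Rightarrow> bool" where
  "optimal G F c \<longleftrightarrow> proper G c \<and> (\<forall>d. proper G d \<longrightarrow> weight G F d \<le> weight G F c)"

text \<open>For \<open>e0\<close> outside \<open>F\<close> this is the edge set of the cycle of the
  2-factor through \<open>e0\<close>. Generating it by adjacency lets arguments go around the cycle
  by induction, without a cyclic order.\<close>

inductive_set factor_cycle :: "('v, 'e) mgraph \<Rightarrow> 'e set \<Rightarrow> 'e \<Rightarrow> 'e set"
  for G F e0 where
  base: "e0 \<in> factor_cycle G F e0"
| step: "e \<in> factor_cycle G F e0 \<Longrightarrow> f \<in> edges G - F \<Longrightarrow> ends G e \<inter> ends G f \<noteq> {} \<Longrightarrow>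
    f \<in> factor_cycle G F e0"

section \<open>Edges at a vertex of a cubic graph with a 1-factor\<close>

locale cubic_one_factor =
  fixes G :: "('v, 'e) mgraph" and F :: "'e set"
  assumes cubic: "cubic G" and perfect: "perfect_matching G F"
begin

lemma mgraph: "multigraph G"
  using cubic unfolding cubic_def by blast

lemma finite_edges: "finite (edges G)"
  using mgraph unfolding multigraph_def by blast

lemma F_edges: "F \<subseteq> edges G"
  using perfect unfolding perfect_matching_def matching_def by blast

lemma F_unique: "f \<in> F \<Longrightarrow> g \<in> F \<Longrightarrow> w \<in> ends G f \<Longrightarrow> w \<in> ends G g \<Longrightarrow> f = g"
  using perfect unfolding perfect_matching_def matching_def by blast

lemma end_vert: "e \<in> edges G \<Longrightarrow> w \<in> ends G e \<Longrightarrow> w \<in> verts G"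
  using mgraph unfolding multigraph_def by blast

lemma other_end:
  assumes "e \<in> edges G" "w \<in> ends G e"
  obtains x where "x \<noteq> w" "ends G e = {w, x}"
proof -
  have "card (ends G e) = 2" using mgraph assms unfolding multigraph_def by blast
  then obtain x y where "x \<noteq> y" "ends G e = {x, y}" by (meson card_2_iff)
  then show ?thesis using assms(2) that by (metis insertE insert_commute singletonD)
qed

text \<open>Exactly one of the three edges at \<open>w\<close> lies in \<open>F\<close>, so
  \<open>e\<close> has exactly one companion outside \<open>F\<close>.\<close>

lemma star:
  assumes "e \<in> edges G - F" "w \<in> ends G e"
  obtains f e' where "f \<in> F" "w \<in> ends G f" "e' \<in> edges G - F" "w \<in> ends G e'" "e' \<noteq> e"
    "\<And>g. g \<in> edges G \<Longrightarrow> w \<in> ends G g \<Longrightarrow> g = f \<or> g = e \<or> g = e'"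
proof -
  have w: "w \<in> verts G" using assms end_vert by blast
  then obtain f where f: "f \<in> F" "w \<in> ends G f"
    using perfect unfolding perfect_matching_def by blast
  let ?T = "{g \<in> edges G. w \<in> ends G g}"
  have "card ?T = 3" using cubic w unfolding cubic_def degree_def by blast
  moreover have "{f, e} \<subseteq> ?T" "f \<noteq> e" using f assms F_edges by auto
  ultimately have "card (?T - {f, e}) = 1"
    by (subst card_Diff_subset) auto
  then obtain e' where e': "?T - {f, e} = {e'}" by (meson card_1_singletonE)
  then have "e' \<in> edges G" "w \<in> ends G e'" "e' \<noteq> e" "e' \<noteq> f" by blast+
  moreover from this have "e' \<notin> F" using F_unique f by blast
  ultimately show ?thesis using that[of f e'] f e' by blast
qed

lemma star_cases:
  assumes "e \<in> edges G - F" "w \<in> ends G e" "e' \<in> edges G - F" "w \<in> ends G e'" "e' \<noteq> e"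
    and g: "g \<in> edges G" "w \<in> ends G g"
  shows "g \<in> F \<or> g = e \<or> g = e'"
proof -
  obtain f h where f: "f \<in> F" and *: "\<And>g. g \<in> edges G \<Longrightarrow> w \<in> ends G g \<Longrightarrow> g = f \<or> g = e \<or> g = h"
    by (rule star[OF assms(1,2)]) blast
  show ?thesis using *[OF g] *[of e'] f assms by blast
qed

lemma finite_coloured: "finite (coloured G c)"
  using finite_edges unfolding coloured_def by simp

lemma properD:
  assumes "proper G c" "e \<in> edges G" "f \<in> edges G" "w \<in> ends G e" "w \<in> ends G f"
    "c e = c f" "c e < 3"
  shows "e = f"
  using assms unfolding proper_def coloured_def by fastforce

lemma properI:
  assumes "\<And>e f w. e \<in> edges G \<Longrightarrow> f \<in> edges G \<Longrightarrow> w \<in> ends G e \<Longrightarrow> w \<in> ends G f \<Longrightarrow> e \<noteq> f \<Longrightarrow>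
    c e = c f \<Longrightarrow> c e < 3 \<Longrightarrow> False"
  shows "proper G c"
  using assms unfolding proper_def coloured_def by fastforce

lemma matching_colour_class:
  assumes "proper G c" "k < 3" "M \<subseteq> {e \<in> edges G. c e = k}"
  shows "matching G M"
  using assms properD[OF assms(1)] unfolding matching_def by blast

section \<open>Optimal colourings\<close>

lemma optimal_proper: "optimal G F c \<Longrightarrow> proper G c"
  unfolding optimal_def by blast

text \<open>One more coloured edge adds \<open>Suc (card (edges G))\<close> to the weight, which
  exceeds anything the second summand can contribute.\<close>

lemma optimal_card:
  assumes "optimal G F c" "proper G d"
  shows "card (coloured G d) \<le> card (coloured G c)"
proof (rule ccontr)
  assume "\<not> ?thesis"
  then have "Suc (card (coloured G c)) * Suc (card (edges G)) \<le> card (coloured G d) * Suc (card (edges G))"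
    by (intro mult_le_mono1) simp
  moreover have "card (coloured G c - F) \<le> card (edges G)"
    using finite_edges by (intro card_mono) (auto simp: coloured_def)
  ultimately have "weight G F c < weight G F d" unfolding weight_def by simp
  then show False using assms unfolding optimal_def by (meson leD)
qed

lemma optimal_card_off:
  assumes "optimal G F c" "proper G d" "card (coloured G d) = card (coloured G c)"
  shows "card (coloured G d - F) \<le> card (coloured G c - F)"
  using assms unfolding optimal_def weight_def by (metis add_le_cancel_left)

lemma optimal_transfer:
  assumes "optimal G F c" "proper G d" "card (coloured G d) = card (coloured G c)"
    "card (coloured G d - F) = card (coloured G c - F)"
  shows "optimal G F d"
  using assms unfolding optimal_def weight_def by metis

lemma optimal_exists: "\<exists>c. optimal G F c"
proof -
  have "proper G (\<lambda>_. 3)" by (rule properI) simp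
  moreover have "weight G F c \<le> card (edges G) * Suc (card (edges G)) + card (edges G)" for c
    unfolding weight_def using finite_edges
    by (intro add_mono mult_le_mono1 card_mono) (auto simp: coloured_def)
  ultimately show ?thesis
    using ex_has_greatest_nat[of "proper G" "\<lambda>_. 3" "weight G F"] unfolding optimal_def by (metis le_imp_less_Suc)
qed

section \<open>Moving a hole\<close>

text \<open>The only possible obstacle \<open>h\<close> loses its colour. Since \<open>e\<close> is
  updated last, \<open>h = e\<close> is allowed and gives the plain colouring of
  \<open>e\<close>.\<close>

lemma recolour_proper:
  assumes c: "proper G c" and e: "ends G e = {u, v}"
    and u: "\<And>g. g \<in> edges G \<Longrightarrow> u \<in> ends G g \<Longrightarrow> c g = k \<Longrightarrow> g = h"
    and v: "\<And>g. g \<in> edges G \<Longrightarrow> v \<in> ends G g \<Longrightarrow> c g = k \<Longrightarrow> g = h"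
  shows "proper G (c(h := 3, e := k))"
proof (rule properI)
  fix f g w
  assume *: "f \<in> edges G" "g \<in> edges G" "w \<in> ends G f" "w \<in> ends G g" "f \<noteq> g"
    "(c(h := 3, e := k)) f = (c(h := 3, e := k)) g" "(c(h := 3, e := k)) f < 3"
  consider "f = e" | "g = e" | "f \<noteq> e" "g \<noteq> e" by blast
  then show False
  proof cases
    case 1
    then show ?thesis using * e u[of g] v[of g] by (auto split: if_splits)
  next
    case 2
    then show ?thesis using * e u[of f] v[of f] by (auto split: if_splits)
  next
    case 3
    then show ?thesis using * properD[OF c *(1-4)] by (auto split: if_splits)
  qed
qed

text \<open>A colour missing at both ends could be given to the hole, which would yield one more
  coloured edge.\<close>

lemma no_common_missing:
  assumes c: "optimal G F c" and e: "e \<in> edges G" "c e \<ge> 3" "ends G e = {u, v}" and k: "k < 3"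
    and u: "\<And>g. g \<in> edges G \<Longrightarrow> u \<in> ends G g \<Longrightarrow> c g \<noteq> k"
  shows "\<exists>g\<in>edges G. v \<in> ends G g \<and> c g = k"
proof (rule ccontr)
  assume "\<not> ?thesis"
  then have "proper G (c(e := 3, e := k))"
    using u by (intro recolour_proper[OF optimal_proper[OF c] e(3)]) auto
  moreover have "coloured G (c(e := 3, e := k)) = insert e (coloured G c)"
    using e k unfolding coloured_def by auto
  moreover have "e \<notin> coloured G c" using e unfolding coloured_def by auto
  ultimately show False
    using optimal_card[OF c, of "c(e := 3, e := k)"] finite_coloured by simp
qed

text \<open>The number of coloured edges stays the same. If \<open>h\<close> were in
  \<open>F\<close>, one more edge outside \<open>F\<close> would be coloured, against optimality;
  otherwise that number stays the same too.\<close>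

lemma move_hole:
  assumes c: "optimal G F c" and e: "e \<in> edges G - F" "c e \<ge> 3" "ends G e = {u, v}"
    and h: "h \<in> edges G" "u \<in> ends G h" "c h < 3"
    and v: "\<And>g. g \<in> edges G \<Longrightarrow> v \<in> ends G g \<Longrightarrow> c g \<noteq> c h"
  shows "h \<notin> F" "optimal G F (c(h := 3, e := c h))"
    "coloured G (c(h := 3, e := c h)) = insert e (coloured G c) - {h}"
proof -
  let ?d = "c(h := 3, e := c h)"
  have pr: "proper G ?d"
  proof (rule recolour_proper[OF optimal_proper[OF c] e(3)])
    show "g = h" if "g \<in> edges G" "u \<in> ends G g" "c g = c h" for g
      using properD[OF optimal_proper[OF c] that(1) h(1) that(2) h(2) that(3)] that h by simp
  qed (use v in blast)
  show col: "coloured G ?d = insert e (coloured G c) - {h}"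
    using e h unfolding coloured_def by auto
  have *: "e \<notin> coloured G c" "h \<in> coloured G c" using e h unfolding coloured_def by auto
  then have card: "card (coloured G ?d) = card (coloured G c)"
    using col finite_coloured[of c] card_gt_0_iff[of "coloured G c"] by simp
  show "h \<notin> F"
  proof
    assume "h \<in> F"
    then have "coloured G ?d - F = insert e (coloured G c - F)" using col e by auto
    then have "card (coloured G ?d - F) = Suc (card (coloured G c - F))"
      using * finite_coloured[of c] by simp
    then show False using optimal_card_off[OF c pr card] by simp
  qed
  then have "coloured G ?d - F = insert e (coloured G c - F) - {h}" "h \<in> coloured G c - F"
    using col e * by auto
  then have "card (coloured G ?d - F) = card (coloured G c - F)"
    using * finite_coloured[of c] card_gt_0_iff[of "coloured G c - F"]
    by simp
  then show "optimal G F ?d" using optimal_transfer[OF c pr card] by blast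
qed

text \<open>Some colour is missing at each end of the hole. It occurs at the other end by
  \<open>no_common_missing\<close>, and not on an edge of \<open>F\<close> by
  \<open>move_hole\<close>, so it is the colour of \<open>ev\<close> or \<open>eu\<close>
  respectively.\<close>

lemma hole_structure:
  assumes c: "optimal G F c" and e: "e \<in> edges G - F" "c e \<ge> 3" "ends G e = {u, v}"
    and eu: "eu \<in> edges G - F" "u \<in> ends G eu" "eu \<noteq> e"
    and ev: "ev \<in> edges G - F" "v \<in> ends G ev" "ev \<noteq> e"
    and fu: "fu \<in> F" "u \<in> ends G fu" and fv: "fv \<in> F" "v \<in> ends G fv"
  shows "c eu < 3" "c ev < 3" "c fu < 3" "c fv = c fu" "distinct [c eu, c ev, c fu]"
    "\<And>g. g \<in> edges G \<Longrightarrow> u \<in> ends G g \<Longrightarrow> c g \<noteq> c ev"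
    "\<And>g. g \<in> edges G \<Longrightarrow> v \<in> ends G g \<Longrightarrow> c g \<noteq> c eu"
proof -
  have step: "c ey = k" if ends: "ends G e = {x, y}"
    and ey: "ey \<in> edges G - F" "y \<in> ends G ey" "ey \<noteq> e" and "k < 3"
    and miss: "\<And>g. g \<in> edges G \<Longrightarrow> x \<in> ends G g \<Longrightarrow> c g \<noteq> k" for x y ey k
  proof -
    obtain g where g: "g \<in> edges G" "y \<in> ends G g" "c g = k"
      using no_common_missing[OF c _ e(2) ends \<open>k < 3\<close> miss] e(1) by blast
    have "g \<notin> F"
      using move_hole(1)[OF c e(1,2), of y x g] ends g miss \<open>k < 3\<close> by (simp add: insert_commute)
    moreover have "g \<noteq> e" using g e \<open>k < 3\<close> by auto
    moreover have "y \<in> ends G e" using ends by blast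
    ultimately show ?thesis using star_cases[OF e(1) _ ey g(1,2)] g(3) by blast
  qed
  have miss: "\<exists>k<3. \<forall>g\<in>edges G. x \<in> ends G g \<longrightarrow> c g \<noteq> k" if "x \<in> ends G e" for x
  proof -
    obtain f e' where *: "\<And>g. g \<in> edges G \<Longrightarrow> x \<in> ends G g \<Longrightarrow> g = f \<or> g = e \<or> g = e'"
      by (rule star[OF e(1) \<open>x \<in> ends G e\<close>]) blast
    have "\<exists>k<3. k \<noteq> c f \<and> k \<noteq> c e'" by presburger
    then obtain k where "k < 3" "k \<noteq> c f" "k \<noteq> c e'" by blast
    then show ?thesis using * e(2) by (metis not_le)
  qed
  have ends': "ends G e = {v, u}" using e(3) by blast
  obtain p where p: "p < 3" "\<forall>g\<in>edges G. u \<in> ends G g \<longrightarrow> c g \<noteq> p" using miss[of u] e(3) by auto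
  obtain q where q: "q < 3" "\<forall>g\<in>edges G. v \<in> ends G g \<longrightarrow> c g \<noteq> q" using miss[of v] e(3) by auto
  have evp: "c ev = p" using step[OF e(3) ev p(1)] p by blast
  have euq: "c eu = q" using step[OF ends' eu q(1)] q by blast
  show *: "c eu < 3" "c ev < 3" using evp euq p q by auto
  show missu: "c g \<noteq> c ev" if "g \<in> edges G" "u \<in> ends G g" for g using evp p that by blast
  show missv: "c g \<noteq> c eu" if "g \<in> edges G" "v \<in> ends G g" for g using euq q that by blast
  have pq: "p \<noteq> q" using euq p eu by auto
  \<comment> \<open>If the third colour were missing at an end, \<open>step\<close> would put it on
    \<open>ev\<close> or \<open>eu\<close>. So it occurs at both ends, where only the edge of
    \<open>F\<close> is left for it.\<close>
  have third: "c fx = r" if "r < 3" "r \<noteq> p" "r \<noteq> q" "x \<in> {u, v}" "fx \<in> F" "x \<in> ends G fx" for r x fx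
  proof -
    have "\<exists>g\<in>edges G. x \<in> ends G g \<and> c g = r"
    proof (rule ccontr)
      assume *: "\<not> ?thesis"
      from that(4) have "r = p \<or> r = q"
      proof
        assume "x = u" then show ?thesis using step[OF e(3) ev that(1)] * evp by blast
      next
        assume "x \<in> {v}" then show ?thesis using step[OF ends' eu that(1)] * euq by blast
      qed
      then show False using that by blast
    qed
    then obtain g where g: "g \<in> edges G" "x \<in> ends G g" "c g = r" by blast
    moreover have "x \<in> ends G e" using that e by blast
    moreover have "c g \<noteq> c eu" "c g \<noteq> c ev" "g \<noteq> e" using g that evp euq e by auto
    moreover have "x = u \<or> x = v" using that by blast
    ultimately have "g \<in> F" using star_cases[OF e(1) _ eu] star_cases[OF e(1) _ ev] by blast
    then show ?thesis using F_unique that g by blast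
  qed
  have "\<exists>r<3. r \<noteq> p \<and> r \<noteq> q" by presburger
  then obtain r where r: "r < 3" "r \<noteq> p" "r \<noteq> q" by blast
  have "c fu = r" "c fv = r" using third[OF r] fu fv by auto
  then show "c fu < 3" "c fv = c fu" "distinct [c eu, c ev, c fu]" using r evp euq pq by auto
qed

text \<open>This frees \<open>hole_structure\<close> from naming the other edges. The case
  \<open>u = v\<close> is included because the induction along the cycle may meet the same end
  twice.\<close>

lemma hole_F_colour:
  assumes "optimal G F c" "e \<in> edges G - F" "c e \<ge> 3" "u \<in> ends G e" "v \<in> ends G e"
    and "f \<in> F" "u \<in> ends G f" "g \<in> F" "v \<in> ends G g"
  shows "c f = c g"
proof (cases "u = v")
  case True
  then show ?thesis using F_unique assms by blast
next
  case False
  then have "ends G e = {u, v}" using other_end[of e u] assms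
    by (metis DiffD1 insertE singletonD)
  moreover obtain eu where "eu \<in> edges G - F" "u \<in> ends G eu" "eu \<noteq> e"
    by (rule star[OF assms(2,4)])
  moreover obtain ev where "ev \<in> edges G - F" "v \<in> ends G ev" "ev \<noteq> e"
    by (rule star[OF assms(2,5)])
  ultimately show ?thesis
    using hole_structure(4)[OF assms(1-3), of u v eu ev f g] assms by simp
qed

section \<open>Kempe exchange\<close>

text \<open>\<open>S\<close> is closed under the edges coloured \<open>k\<close> or
  \<open>l\<close>, so at each vertex these two colours are exchanged on all edges or on none. The
  set of coloured edges does not change.\<close>

lemma swap_optimal:
  assumes c: "optimal G F c" and k: "k < 3" "l < 3"
    and S: "\<And>g. g \<in> edges G \<Longrightarrow> c g \<in> {k, l} \<Longrightarrow> ends G g \<inter> S \<noteq> {} \<Longrightarrow> ends G g \<subseteq> S"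
  defines "d \<equiv> \<lambda>g. if ends G g \<inter> S \<noteq> {} then transpose k l (c g) else c g"
  shows "optimal G F d" "coloured G d = coloured G c"
proof -
  have lt: "d g < 3 \<longleftrightarrow> c g < 3" for g
    using k unfolding d_def transpose_def by auto
  then show col: "coloured G d = coloured G c" unfolding coloured_def by simp
  have "proper G d"
  proof (rule properI)
    fix f g w
    assume *: "f \<in> edges G" "g \<in> edges G" "w \<in> ends G f" "w \<in> ends G g" "f \<noteq> g" "d f = d g" "d f < 3"
    have "c f = c g"
    proof (cases "w \<in> S")
      case True
      then have "d f = transpose k l (c f)" "d g = transpose k l (c g)"
        using * unfolding d_def by (meson disjoint_iff)+
      then show ?thesis using *(6) transpose_eq_iff by metis
    next
      case False
      \<comment> \<open>An edge at \<open>w\<close> that meets \<open>S\<close> has neither of the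
        two colours, and \<open>transpose\<close> fixes its colour.\<close>
      have "d h = c h" if "h \<in> edges G" "w \<in> ends G h" for h
        using S[OF that(1)] that(2) False unfolding d_def transpose_def by auto
      then show ?thesis using * by metis
    qed
    then show False using properD[OF optimal_proper[OF c] *(1-4)] * lt by blast
  qed
  then show "optimal G F d" using optimal_transfer[OF c] col by simp
qed

section \<open>Rotating the hole around its cycle\<close>

lemma factor_cycle_edges:
  assumes "e0 \<in> edges G - F" "e \<in> factor_cycle G F e0"
  shows "e \<in> edges G - F"
  using assms(2,1) by cases auto

text \<open>The hole moves from edge to adjacent edge, recolouring only edges of the cycle. The
  first conjunct records that \<open>e0\<close> was the only hole on it.\<close>

lemma rotate_hole:
  assumes c: "optimal G F c" and e0: "e0 \<in> edges G - F" "c e0 \<ge> 3"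
    and e: "e \<in> factor_cycle G F e0"
  shows "e \<in> insert e0 (coloured G c) \<and> (\<exists>d. optimal G F d \<and>
    coloured G d = insert e0 (coloured G c) - {e} \<and> (\<forall>g. g \<notin> factor_cycle G F e0 \<longrightarrow> d g = c g))"
  using e
proof induction
  case base
  have "coloured G c = insert e0 (coloured G c) - {e0}" using e0 unfolding coloured_def by auto
  then show ?case using c by blast
next
  case (step e h)
  show ?case
  proof (cases "h = e")
    case False
    obtain d where d: "optimal G F d" "coloured G d = insert e0 (coloured G c) - {e}"
      "\<forall>g. g \<notin> factor_cycle G F e0 \<longrightarrow> d g = c g" using step by blast
    have e: "e \<in> edges G - F" using factor_cycle_edges e0 step by blast
    have "e \<notin> coloured G d" using d by blast
    then have hole: "d e \<ge> 3" using e unfolding coloured_def by auto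
    obtain u where u: "u \<in> ends G e" "u \<in> ends G h" using step by blast
    obtain v where v: "v \<noteq> u" "ends G e = {u, v}" using other_end e u by blast
    then have "v \<in> ends G e" by blast
    obtain fu where fu: "fu \<in> F" "u \<in> ends G fu" by (rule star[OF e u(1)])
    obtain fv ev where fv: "fv \<in> F" "v \<in> ends G fv" and ev: "ev \<in> edges G - F" "v \<in> ends G ev" "ev \<noteq> e"
      by (rule star[OF e \<open>v \<in> ends G e\<close>])
    \<comment> \<open>With \<open>h\<close> in the role of \<open>eu\<close>, \<open>hs(7)\<close>
      says that its colour is missing at \<open>v\<close>, as \<open>move_hole\<close>
      requires.\<close>
    note hs = hole_structure[OF d(1) e hole v(2) step(2) u(2) False ev fu fv]
    let ?d = "d(h := 3, e := d h)"
    have "h \<in> edges G" using step by blast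
    note mh = move_hole[OF d(1) e hole v(2) this u(2) hs(1,7)]
    have "h \<in> coloured G d" using hs(1) step unfolding coloured_def by blast
    moreover have "coloured G ?d = insert e0 (coloured G c) - {h}" using mh(3) d(2) step by auto
    moreover have "h \<in> factor_cycle G F e0" using factor_cycle.step[OF step(1-3)] .
    then have "\<forall>g. g \<notin> factor_cycle G F e0 \<longrightarrow> ?d g = c g" using d(3) step by auto
    ultimately show ?thesis using mh(2) d(2) by blast
  qed (use step in blast)
qed

text \<open>With the hole rotated to \<open>h\<close>, the edges of \<open>F\<close> at its two ends
  have equal colours. They lie off the cycle, so they had these colours under \<open>c\<close>
  already.\<close>

lemma factor_cycle_F_colour:
  assumes c: "optimal G F c" and e0: "e0 \<in> edges G - F" "c e0 \<ge> 3"
    and f0: "f0 \<in> F" "ends G f0 \<inter> ends G e0 \<noteq> {}"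
    and e: "e \<in> factor_cycle G F e0" and f: "f \<in> F" "ends G f \<inter> ends G e \<noteq> {}"
  shows "c f = c f0"
  using e f
proof (induction arbitrary: f)
  case base
  then show ?case using hole_F_colour[OF c e0] f0 by blast
next
  case (step e h)
  have h: "h \<in> factor_cycle G F e0" using factor_cycle.step[OF step(1-3)] .
  obtain d where d: "optimal G F d" "coloured G d = insert e0 (coloured G c) - {h}"
    "\<forall>g. g \<notin> factor_cycle G F e0 \<longrightarrow> d g = c g" using rotate_hole[OF c e0 h] by blast
  have "h \<notin> coloured G d" using d by blast
  then have hole: "d h \<ge> 3" using step unfolding coloured_def by auto
  obtain u where u: "u \<in> ends G e" "u \<in> ends G h" using step by blast
  obtain g where g: "g \<in> F" "u \<in> ends G g" by (rule star[OF step(2) u(2)])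
  have "d f = d g" using hole_F_colour[OF d(1) step(2) hole] u g step.prems by blast
  moreover have "f \<notin> factor_cycle G F e0" "g \<notin> factor_cycle G F e0"
    using factor_cycle_edges[OF e0(1)] step.prems g by blast+
  moreover have "c g = c f0" using step.IH g u by blast
  ultimately show ?case using d by metis
qed

section \<open>Excluding holes outside \<open>F\<close>\<close>

lemma no_hole:
  assumes c: "optimal G F c" and e0: "e0 \<in> edges G - F"
  shows "c e0 < 3"
proof (rule ccontr)
  assume "\<not> ?thesis"
  then have hole: "c e0 \<ge> 3" by simp
  define C where "C = factor_cycle G F e0"
  define W where "W = \<Union> (ends G ` C)"
  have C_edges: "e \<in> edges G - F" if "e \<in> C" for e
    using factor_cycle_edges[OF e0] that unfolding C_def by blast
  have C_closed: "h \<in> C" if "w \<in> W" "h \<in> edges G - F" "w \<in> ends G h" for w h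
    using that factor_cycle.step[of _ G F e0 h] unfolding W_def C_def by blast
  have C_W: "ends G e \<subseteq> W" if "e \<in> C" for e using that unfolding W_def by blast
  have e0C: "e0 \<in> C" unfolding C_def by (rule factor_cycle.base)
  have W_verts: "W \<subseteq> verts G" using C_edges end_vert unfolding W_def by blast
  have finV: "finite (verts G)" using mgraph unfolding multigraph_def by blast
  obtain u where u: "u \<in> ends G e0"
    using mgraph e0 unfolding multigraph_def by fastforce
  then obtain v where v: "v \<noteq> u" "ends G e0 = {u, v}" using other_end e0 by blast
  then have v': "v \<in> ends G e0" by blast
  obtain fu eu where fu: "fu \<in> F" "u \<in> ends G fu" and eu: "eu \<in> edges G - F" "u \<in> ends G eu" "eu \<noteq> e0"
    by (rule star[OF e0 u])
  obtain fv ev where fv: "fv \<in> F" "v \<in> ends G fv" and ev: "ev \<in> edges G - F" "v \<in> ends G ev" "ev \<noteq> e0"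
    by (rule star[OF e0 v'])
  note hs = hole_structure[OF c e0 hole v(2) eu ev fu fv]
  \<comment> \<open>By \<open>hs(6)\<close> and \<open>hs(7)\<close>, \<alpha> is missing at
    \<open>u\<close> and \<beta> at \<open>v\<close>; the edges of \<open>F\<close> at both have the
    colour \<gamma>.\<close>
  define \<alpha> \<beta> \<gamma> where "\<alpha> = c ev" and "\<beta> = c eu" and "\<gamma> = c fu"
  note col_defs = \<alpha>_def \<beta>_def \<gamma>_def
  have cols: "\<alpha> < 3" "\<beta> < 3" "\<gamma> < 3" "\<alpha> \<noteq> \<beta>" "\<alpha> \<noteq> \<gamma>" "\<beta> \<noteq> \<gamma>"
    using hs(1-5) unfolding col_defs by auto
  have three: "k = \<alpha> \<or> k = \<beta> \<or> k = \<gamma>" if "k < 3" for k using that cols by arith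
  have F_col: "c f = \<gamma>" if "f \<in> F" "w \<in> W" "w \<in> ends G f" for f w
  proof -
    obtain e where "e \<in> C" "w \<in> ends G e" using \<open>w \<in> W\<close> unfolding W_def by blast
    then show ?thesis
      using factor_cycle_F_colour[OF c e0 hole fu(1), of e f] that u fu unfolding C_def \<gamma>_def by blast
  qed

  \<comment> \<open>The \<alpha>-edges of \<open>C\<close> match all vertices of \<open>W\<close>
    except \<open>u\<close>, which makes \<open>card W\<close> odd.\<close>
  define M where "M = {g \<in> C. c g = \<alpha>}"
  have matM: "matching G M"
    by (rule matching_colour_class[OF optimal_proper[OF c] cols(1)]) (use C_edges in \<open>auto simp: M_def\<close>)
  have mate_ne: "mate G M w \<noteq> w" if w: "w \<in> W" "w \<noteq> u" for w
  proof -
    obtain e1 where e1: "e1 \<in> C" "w \<in> ends G e1" using w unfolding W_def by blast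
    obtain f e2 where f: "f \<in> F" "w \<in> ends G f" and e2: "e2 \<in> edges G - F" "w \<in> ends G e2" "e2 \<noteq> e1"
      by (rule star[OF C_edges[OF e1(1)] e1(2)])
    have e2C: "e2 \<in> C" using C_closed w e2 by blast
    have "\<exists>g\<in>M. w \<in> ends G g"
    proof (cases "w \<in> ends G e0")
      case True
      then have "w = v" using v w by blast
      moreover have "ev \<in> C" using C_closed[OF _ ev(1,2)] C_W[OF e0C] v' by blast
      ultimately show ?thesis using ev unfolding M_def \<alpha>_def by blast
    next
      case False
      \<comment> \<open>Both cycle edges at \<open>w\<close> are coloured because \<open>e0\<close>
        is not at \<open>w\<close>. They avoid \<gamma>, the colour of \<open>f\<close>, so one of
        them has the colour \<alpha>.\<close>
      have coloured: "c g < 3" if "g \<in> C" "w \<in> ends G g" for g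
        using rotate_hole[OF c e0 hole, of g] that False unfolding C_def coloured_def by auto
      have "c e1 \<noteq> c e2"
        using properD[OF optimal_proper[OF c], of e1 e2 w] C_edges e1 e2 coloured by blast
      moreover have "c g \<noteq> \<gamma>" if "g \<in> C" "w \<in> ends G g" for g
        using properD[OF optimal_proper[OF c], of g f w] C_edges[OF that(1)] that coloured[OF that]
          F_col[OF f(1) w(1) f(2)] f F_edges by auto
      ultimately have "c e1 = \<alpha> \<or> c e2 = \<alpha>"
        using three[OF coloured[OF e1]] three[OF coloured[OF e2C e2(2)]] e1 e2 e2C by metis
      then show ?thesis using e1 e2 e2C unfolding M_def by blast
    qed
    then obtain g where g: "g \<in> M" "w \<in> ends G g" by blast
    then have "g \<in> edges G" using C_edges unfolding M_def by blast
    then obtain x where "x \<noteq> w" "ends G g = {w, x}" using other_end g by blast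
    then show ?thesis using mate_eq[OF matM g(1)] by metis
  qed
  have mate_W: "mate G M w \<in> W" if "w \<in> W" for w
  proof (cases rule: mate_cases[OF matM, of w])
    case (2 g)
    then have "g \<in> C" unfolding M_def by blast
    then show ?thesis using C_W 2(2) by blast
  qed (use that in simp)
  have mate_u: "mate G M u = u"
    using hs(6) C_edges by (intro mate_self) (auto simp: M_def \<alpha>_def)
  have finW: "finite W" using finV W_verts finite_subset by blast
  have "even (card (W - {u}))"
  proof (rule even_card_involution[of _ "mate G M"])
    fix w assume w: "w \<in> W - {u}"
    have "mate G M w \<noteq> u" using mate_mate[OF matM, of w] mate_u w by auto
    then show "mate G M w \<in> W - {u}" using mate_W w by blast
  qed (use finW mate_ne mate_mate[OF matM] in auto)
  moreover have "u \<in> W" using C_W[OF e0C] u by blast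
  then have "card W = Suc (card (W - {u}))" using finW by (metis card_Suc_Diff1)
  ultimately have oddW: "odd (card W)" by simp

  \<comment> \<open>Leaving out \<open>C\<close> makes \<open>mate G A\<close> fix \<open>W\<close>:
    an edge off \<open>C\<close> at a vertex of \<open>W\<close> is in \<open>F\<close> and has the
    colour \<gamma>. So each vertex of \<open>W\<close> is an end of its
    \<alpha>\<gamma>-path.\<close>
  define A where "A = {g \<in> edges G. g \<notin> C \<and> c g = \<alpha>}"
  define B where "B = {g \<in> edges G. c g = \<gamma>}"
  have matA: "matching G A"
    by (rule matching_colour_class[OF optimal_proper[OF c] cols(1)]) (auto simp: A_def)
  have matB: "matching G B"
    by (rule matching_colour_class[OF optimal_proper[OF c] cols(3)]) (auto simp: B_def)
  have fixA: "mate G A w = w" if "w \<in> W" for w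
  proof (rule mate_self)
    fix g assume g: "g \<in> A"
    show "w \<notin> ends G g"
    proof
      assume "w \<in> ends G g"
      then show False using g C_closed[OF that] F_col[OF _ that] cols(5) unfolding A_def by auto
    qed
  qed
  have "\<exists>t S. S \<subseteq> verts G \<and> S \<inter> W = {t} \<and> mate G A ` S \<subseteq> S \<and> mate G B ` S \<subseteq> S"
    using finV W_verts oddW fixA mate_in_verts[OF mgraph] matA matB mate_mate
    by (intro involutions_orbit_single) auto
  then obtain t S where SW: "S \<inter> W = {t}" and SA: "mate G A ` S \<subseteq> S" and SB: "mate G B ` S \<subseteq> S"
    by (elim exE conjE) (rule that)
  have tS: "t \<in> S" and tW: "t \<in> W" using SW by blast+

  \<comment> \<open>Either cycle edge at \<open>t\<close> will do as the new place of the hole; what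
    matters is that its other end \<open>s\<close> lies outside \<open>S\<close>.\<close>
  obtain e where e: "e \<in> C" "t \<in> ends G e" using tW unfolding W_def by blast
  note eE = C_edges[OF e(1)]
  obtain s where s: "s \<noteq> t" "ends G e = {t, s}" using other_end eE e by blast
  then have s': "s \<in> ends G e" by blast
  then have sW: "s \<in> W" using C_W[OF e(1)] by blast
  then have sS: "s \<notin> S" using SW s by blast
  have "\<exists>d. optimal G F d \<and> coloured G d = insert e0 (coloured G c) - {e} \<and> (\<forall>g. g \<notin> C \<longrightarrow> d g = c g)"
    using rotate_hole[OF c e0 hole] e(1) unfolding C_def by blast
  then obtain d where d: "optimal G F d" "coloured G d = insert e0 (coloured G c) - {e}"
    and d_off: "\<And>g. g \<notin> C \<Longrightarrow> d g = c g" by blast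
  have d_hole: "e \<notin> coloured G d" using d by blast
  then have d_hole': "d e \<ge> 3" using eE unfolding coloured_def by auto
  obtain ft et where ft: "ft \<in> F" "t \<in> ends G ft" and et: "et \<in> edges G - F" "t \<in> ends G et" "et \<noteq> e"
    by (rule star[OF eE e(2)])
  obtain fs es where fs: "fs \<in> F" "s \<in> ends G fs" and es: "es \<in> edges G - F" "s \<in> ends G es" "es \<noteq> e"
    by (rule star[OF eE s'])
  note hs' = hole_structure[OF d(1) eE d_hole' s(2) et es ft fs]
  have F_off: "f \<notin> C" if "f \<in> F" for f using C_edges that by blast
  have dF: "d f = \<gamma>" if "f \<in> F" "w \<in> W" "w \<in> ends G f" for f w
    using d_off[OF F_off] F_col that by metis
  \<comment> \<open>If \<open>\<beta>\<close> is the colour missing at \<open>t\<close>, exchange \<open>\<alpha>\<close> and \<open>\<beta>\<close> on all of \<open>C\<close>.\<close>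
  have "\<exists>d'. optimal G F d' \<and> coloured G d' = coloured G d \<and> (\<forall>g\<in>edges G - C. d' g = c g) \<and>
    (\<forall>g\<in>edges G. t \<in> ends G g \<longrightarrow> d' g \<noteq> \<alpha>)"
  proof (cases "d es = \<alpha>")
    case True
    then show ?thesis using d(1) d_off hs'(6) by (intro exI[of _ d]) auto
  next
    case False
    have "d ft = \<gamma>" using dF ft tW by blast
    then have dis: "d es = \<beta>" using three[OF hs'(2)] hs'(5) False by auto
    let ?d = "\<lambda>g. if ends G g \<inter> W \<noteq> {} then transpose \<alpha> \<beta> (d g) else d g"
    \<comment> \<open>Edges at \<open>W\<close> lie in \<open>C\<close> or in \<open>F\<close>, and
      those in \<open>F\<close> have the colour \<gamma>; so the \<alpha>\<beta>-edges meeting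
      \<open>W\<close> stay inside it.\<close>
    have cl: "ends G g \<subseteq> W" if "g \<in> edges G" "d g \<in> {\<alpha>, \<beta>}" "ends G g \<inter> W \<noteq> {}" for g
      using that C_closed C_W dF cols by (metis DiffI disjoint_iff insertE singletonD)
    note sw = swap_optimal[OF d(1) cols(1,2) cl]
    have "?d g = c g" if "g \<in> edges G - C" for g
    proof (cases "ends G g \<inter> W = {}")
      case False
      then have "g \<in> F" using C_closed that by blast
      then have "d g = \<gamma>" using dF False by blast
      then show ?thesis using d_off[of g] that cols False by (simp add: transpose_def)
    qed (use d_off that in auto)
    moreover have "?d g \<noteq> \<alpha>" if "g \<in> edges G" "t \<in> ends G g" for g
      using hs'(6)[OF that] dis tW that cols by (auto simp: transpose_def)
    ultimately show ?thesis using sw by (intro exI[of _ ?d]) blast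
  qed
  then obtain d' where d': "optimal G F d'" "coloured G d' = coloured G d"
    and d'_off: "\<And>g. g \<in> edges G - C \<Longrightarrow> d' g = c g"
    and d'_t: "\<And>g. g \<in> edges G \<Longrightarrow> t \<in> ends G g \<Longrightarrow> d' g \<noteq> \<alpha>" by blast
  have d'F: "d' f = \<gamma>" if "f \<in> F" "w \<in> W" "w \<in> ends G f" for f w
    using d'_off[of f] F_off F_col F_edges that by (metis DiffI subsetD)
  \<comment> \<open>An edge of \<open>C\<close> meeting \<open>S\<close> does so at
    \<open>t\<close>, where \<alpha> is missing and \<gamma> is used by \<open>ft\<close>, so it has
    neither colour. Off \<open>C\<close> the colours are those of \<open>c\<close>, and
    \<open>S\<close> is closed under both mates.\<close>
  have cl: "ends G g \<subseteq> S" if g: "g \<in> edges G" "d' g \<in> {\<alpha>, \<gamma>}" "ends G g \<inter> S \<noteq> {}" for g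
  proof -
    obtain x where x: "x \<in> ends G g" "x \<in> S" using g by blast
    obtain y where y: "y \<noteq> x" "ends G g = {x, y}" using other_end g x by blast
    show ?thesis
    proof (cases "g \<in> C")
      case True
      then have "x = t" using C_W x SW by blast
      then have "d' g = d' ft" "t \<in> ends G g" using d'_t g x d'F[OF ft(1) tW ft(2)] by auto
      then have "g = ft"
        using properD[OF optimal_proper[OF d'(1)], of g ft t] g ft F_edges cols by auto
      then show ?thesis using ft F_off True by blast
    next
      case False
      then have "g \<in> A \<or> g \<in> B" using d'_off[of g] g unfolding A_def B_def by auto
      then have "y = mate G A x \<or> y = mate G B x"
        using mate_eq[OF matA _ y(2,1)] mate_eq[OF matB _ y(2,1)] by metis
      moreover have "mate G A x \<in> S" "mate G B x \<in> S"
        using SA SB x(2) by (simp_all add: image_subset_iff)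
      ultimately show ?thesis using y x by auto
    qed
  qed
  \<comment> \<open>The exchange turns \<open>ft\<close> from \<gamma> to \<alpha>. It leaves
    \<open>fs\<close> alone, since otherwise \<open>cl\<close> would put \<open>s\<close> into
    \<open>S\<close>; the hole is still \<open>e\<close>.\<close>
  let ?d = "\<lambda>g. if ends G g \<inter> S \<noteq> {} then transpose \<alpha> \<gamma> (d' g) else d' g"
  note sw = swap_optimal[OF d'(1) cols(1,3) cl]
  have "e \<notin> coloured G ?d" using sw(2) d'(2) d_hole by simp
  then have "?d e \<ge> 3" using eE unfolding coloured_def by auto
  then have "?d ft = ?d fs" using hole_F_colour[OF sw(1) eE _ e(2) s' ft fs] by blast
  moreover have "?d ft = \<alpha>" using tS ft d'F[OF ft(1) tW ft(2)] by auto
  moreover have "d' fs = \<gamma>" using d'F[OF fs(1) sW fs(2)] .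
  then have "ends G fs \<inter> S = {}" using cl[of fs] fs F_edges sS by blast
  then have "?d fs = \<gamma>" using \<open>d' fs = \<gamma>\<close> by simp
  ultimately show False using cols by simp
qed

section \<open>Comparison with \<open>nu 3 G\<close>\<close>

text \<open>Proper partial colourings and triples of disjoint matchings correspond through the
  colour classes, and an optimal colouring has the most coloured edges.\<close>

lemma card_coloured_eq_nu:
  assumes "optimal G F c"
  shows "card (coloured G c) = nu 3 G"
proof (rule antisym)
  let ?N = "{(\<Sum>i<3. card (M i)) | M. disjoint_matchings G 3 M}"
  have pr: "proper G c" by (rule optimal_proper[OF assms])
  let ?M = "\<lambda>i. {e \<in> edges G. c e = i}"
  have "disjoint_matchings G 3 ?M"
    unfolding disjoint_matchings_def using matching_colour_class[OF pr] by blast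
  moreover have "coloured G c = (\<Union>i<3. ?M i)" unfolding coloured_def by auto
  then have "card (coloured G c) = (\<Sum>i<3. card (?M i))"
    using finite_edges by (simp only:) (intro card_UN_disjoint, auto)
  ultimately have "card (coloured G c) \<in> ?N" by (intro CollectI exI conjI)
  then show "card (coloured G c) \<le> nu 3 G"
    unfolding nu_def using nu_set_finite_nonempty(1)[OF mgraph] by (rule Max_ge[rotated])
  have "nu 3 G \<in> ?N"
    unfolding nu_def using nu_set_finite_nonempty[OF mgraph] by (rule Max_in)
  then obtain M where M: "nu 3 G = (\<Sum>i<3. card (M i))" "disjoint_matchings G 3 M" by blast
  \<comment> \<open>The colour is the index of the unique matching containing \<open>e\<close>; the
    default 3 means uncoloured.\<close>
  define d where "d e = (if \<exists>i<3. e \<in> M i then THE i. i < 3 \<and> e \<in> M i else 3)" for e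
  have disj: "i = j" if "i < 3" "j < 3" "e \<in> M i" "e \<in> M j" for i j e
    using M(2) that unfolding disjoint_matchings_def by blast
  have mat: "matching G (M i)" if "i < 3" for i
    using M(2) that unfolding disjoint_matchings_def by blast
  have d_eq: "d e = i" if "i < 3" "e \<in> M i" for e i
    using that disj unfolding d_def by (auto intro!: the_equality)
  have d_in: "e \<in> M (d e)" if "d e < 3" for e
  proof -
    have "\<exists>i<3. e \<in> M i"
    proof (rule ccontr)
      assume "\<not> ?thesis"
      then have "d e = 3" unfolding d_def by (rule if_not_P)
      then show False using that by simp
    qed
    then obtain i where "i < 3" "e \<in> M i" by blast
    then show ?thesis using d_eq by simp
  qed
  have "proper G d"
  proof (rule properI)
    fix e f w
    assume *: "w \<in> ends G e" "w \<in> ends G f" "e \<noteq> f" "d e = d f" "d e < 3"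
    then have "e \<in> M (d e)" "f \<in> M (d e)" using d_in[of e] d_in[of f] by simp_all
    then show False using mat[OF *(5)] * unfolding matching_def by blast
  qed
  moreover have "coloured G d = (\<Union>i<3. M i)"
  proof (intro equalityI subsetI)
    fix e assume "e \<in> coloured G d"
    then have "d e < 3" unfolding coloured_def by blast
    then show "e \<in> (\<Union>i<3. M i)" using d_in[of e] by blast
  next
    fix e assume "e \<in> (\<Union>i<3. M i)"
    then obtain i where i: "i < 3" "e \<in> M i" by blast
    then have "e \<in> edges G" using mat[OF i(1)] unfolding matching_def by blast
    then show "e \<in> coloured G d" using d_eq[OF i] i(1) unfolding coloured_def by simp
  qed
  moreover have "card (\<Union>i<3. M i) = (\<Sum>i<3. card (M i))"
  proof (rule card_UN_disjoint)
    show "\<forall>i\<in>{..<3}. finite (M i)"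
      using mat finite_edges finite_subset unfolding matching_def by (metis lessThan_iff)
    show "\<forall>i\<in>{..<3}. \<forall>j\<in>{..<3}. i \<noteq> j \<longrightarrow> M i \<inter> M j = {}"
      using M(2) unfolding disjoint_matchings_def by (metis lessThan_iff)
  qed simp
  ultimately show "nu 3 G \<le> card (coloured G c)" using optimal_card[OF assms] M(1) by metis
qed

end

section \<open>The subgraph of coloured edges\<close>

theorem theorem3:
  fixes G :: "('v, 'e) mgraph" and F :: "'e set"
  assumes "cubic G" and "perfect_matching G F"
  shows "\<exists>H :: ('v, 'e) mgraph. maximum_edge_colorable 3 G H \<and>
           edges H \<union> F = edges G \<and> edges G - F \<subseteq> edges H"
proof -
  interpret cubic_one_factor G F using assms by unfold_locales
  obtain c where c: "optimal G F c" using optimal_exists by blast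
  let ?H = "\<lparr>verts = verts G, edges = coloured G c, ends = ends G\<rparr> :: ('v, 'e) mgraph"
  have sub: "coloured G c \<subseteq> edges G" unfolding coloured_def by blast
  then have "subgraph ?H G"
    using mgraph finite_coloured unfolding subgraph_def multigraph_def by auto
  moreover have "edge_colorable 3 ?H"
    using optimal_proper[OF c] unfolding edge_colorable_def proper_def
    by (intro exI[of _ c]) (auto simp: coloured_def)
  ultimately have "maximum_edge_colorable 3 G ?H"
    using card_coloured_eq_nu[OF c] unfolding maximum_edge_colorable_def by simp
  moreover have "edges G - F \<subseteq> coloured G c" using no_hole[OF c] unfolding coloured_def by blast
  ultimately show ?thesis using sub F_edges by (intro exI[of _ ?H]) auto
qed

end
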